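(* Let $P\subset\mathbb{R}^d$ be a rational reflexive polytope with denominator $q$. Then \[ h^\ast_P(z) = \left(1+z+\cdots+z^{q-1}\right) h^\ast_{\partial P}(z). \]
   Context: A rational polytope $P\subset\mathbb{R}^d$ is the convex hull of finitely many points of $\mathbb{Q}^d$; it is called rational reflexive if it is $d$-dimensional, contains the origin in its interior, and has a description $P=\{\bm{x}\in\mathbb{R}^d:\mathbf{A}\bm{x}\le\mathbf{1}\}$ with $\mathbf{A}$ an integer matrix and $\mathbf 1$ the all-ones vector (equivalently, its dual polytope is a lattice polytope). Its denominator $q$ is the smallest positive integer with $qP$ a lattice polytope. The $h^\ast$-polynomials are defined by $1+\sum_{n\ge1}|nP\cap\mathbb{Z}^d|\,z^n=\dfrac{h^\ast_P(z)}{(1-z^q)^{d+1}}$ and $1+\sum_{n\ge1}|n\,\partial P\cap\mathbb{Z}^d|\,z^n=\dfrac{h^\ast_{\partial P}(z)}{(1-z^q)^{d}}$, where $\partial P$ is the boundary of $P$. *)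

theory Defs
  imports
    "HOL-Analysis.Analysis"
    "HOL-Computational_Algebra.Computational_Algebra"
begin

definition lattice_points :: "(real ^ 'd) set" where
  "lattice_points = {x. \<forall>i. x $ i \<in> \<int>}"

definition rational_points :: "(real ^ 'd) set" where
  "rational_points = {x. \<forall>i. x $ i \<in> \<rat>}"

definition lattice_polytope :: "(real ^ 'd) set \<Rightarrow> bool" where
  "lattice_polytope P \<longleftrightarrow> (\<exists>V. finite V \<and> V \<subseteq> lattice_points \<and> P = convex hull V)"

definition rational_polytope :: "(real ^ 'd) set \<Rightarrow> bool" where
  "rational_polytope P \<longleftrightarrow> (\<exists>V. finite V \<and> V \<subseteq> rational_points \<and> P = convex hull V)"

text \<open>The integer matrix \<open>A\<close> in the description \<open>P = {x. A x \<le> 1}\<close> has an arbitrary finite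
  number of rows, so it is given by its finite set of rows; the order and repetition of the rows
  do not affect the solution set.\<close>

definition rational_reflexive :: "(real ^ 'd) set \<Rightarrow> bool" where
  "rational_reflexive P \<longleftrightarrow>
     rational_polytope P \<and> aff_dim P = int CARD('d) \<and> 0 \<in> interior P \<and>
     (\<exists>A. finite A \<and> A \<subseteq> lattice_points \<and> P = {x. \<forall>a\<in>A. a \<bullet> x \<le> 1})"

definition dilate :: "nat \<Rightarrow> (real ^ 'd) set \<Rightarrow> (real ^ 'd) set" where
  "dilate n S = (\<lambda>x. real n *\<^sub>R x) ` S"

definition denominator :: "(real ^ 'd) set \<Rightarrow> nat" where
  "denominator P = (LEAST q. 0 < q \<and> lattice_polytope (dilate q P))"

definition ehrhart_series :: "(real ^ 'd) set \<Rightarrow> int fps" where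
  "ehrhart_series S =
     Abs_fps (\<lambda>n. if n = 0 then 1 else int (card (dilate n S \<inter> lattice_points)))"

text \<open>The defining equations of the two polynomials are stated with the denominators
  \<open>(1 - z^q)^(d+1)\<close> and \<open>(1 - z^q)^d\<close> cleared, so that they can be read over the integers. These
  denominators are units among the power series, so there is at most one such polynomial; that there
  is one for a rational polytope (of full dimension) is Ehrhart's theorem.\<close>

definition hstar :: "(real ^ 'd) set \<Rightarrow> int poly" where
  "hstar P = (THE h.
     ehrhart_series P * (1 - fps_X ^ denominator P) ^ (CARD('d) + 1) = fps_of_poly h)"

text \<open>For a full-dimensional \<open>P\<close> the boundary is the topological frontier. The denominator is that of
  \<open>P\<close> itself.\<close>

definition hstar_boundary :: "(real ^ 'd) set \<Rightarrow> int poly" where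
  "hstar_boundary P = (THE h.
     ehrhart_series (frontier P) * (1 - fps_X ^ denominator P) ^ CARD('d) = fps_of_poly h)"

end

theory Submission
  imports Defs
begin

text \<open>Since the facets of \<open>P\<close> lie on the hyperplanes \<open>a \<bullet> x = 1\<close> with \<open>a\<close> integral, the lattice points
  of \<open>n P\<close> are those of the boundary of \<open>n P\<close> together with those of \<open>(n - 1) P\<close>, so the
  two Ehrhart series differ by the factor \<open>1 - z\<close>. What remains is Ehrhart's theorem for the boundary.
  No triangulation is used: the lattice points of the cone over \<open>P\<close> form a finitely generated module
  over the monoid generated by the vertices of \<open>q P\<close>, so a Hilbert--Serre argument shows that
  some power of \<open>1 - z\<^sup>q\<close> clears the denominator. The exponent is then cut down to \<open>d\<close> because \<open>n\<close>
  times the boundary contains only \<open>O(n\<^sup>d\<^sup>-\<^sup>1)\<close> lattice points.\<close>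

section \<open>Finite generation of translation-closed sets in a commutative semigroup\<close>

inductive_set translation_closure :: "'a::ab_semigroup_add set \<Rightarrow> 'a set \<Rightarrow> 'a set" for W F where
  base: "f \<in> F \<Longrightarrow> f \<in> translation_closure W F"
| step: "x \<in> translation_closure W F \<Longrightarrow> w \<in> W \<Longrightarrow> x + w \<in> translation_closure W F"

lemma translation_closure_mono:
  assumes "x \<in> translation_closure W F" "W \<subseteq> W'" "F \<subseteq> F'"
  shows "x \<in> translation_closure W' F'"
  using assms by induction (auto intro: translation_closure.intros)

lemma translation_closure_least:
  assumes "x \<in> translation_closure W F" "F \<subseteq> A" "\<And>a w. a \<in> A \<Longrightarrow> w \<in> W \<Longrightarrow> a + w \<in> A"
  shows "x \<in> A"
  using assms by induction auto

lemma translation_closure_empty [simp]: "translation_closure {} F = F"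
proof -
  have "x \<in> F" if "x \<in> translation_closure {} F" for x
    using that by induction auto
  then show ?thesis by (auto intro: translation_closure.base)
qed

lemma funpow_translation_add:
  fixes x u w :: "'a::ab_semigroup_add"
  shows "((\<lambda>x. x + w) ^^ k) (x + u) = ((\<lambda>x. x + w) ^^ k) x + u"
  by (induction k) (auto simp: ac_simps)

text \<open>By commutativity all translations by \<open>w\<close> can be postponed to the end. They
  are written as an iterate, because a semigroup offers neither a zero nor multiples of
  \<open>w\<close> by \<open>0\<close>.\<close>

lemma translation_closure_insertE:
  assumes "x \<in> translation_closure (insert w W) F"
  obtains k y where "y \<in> translation_closure W F" "x = ((\<lambda>x. x + w) ^^ k) y"
proof -
  have "\<exists>k y. y \<in> translation_closure W F \<and> x = ((\<lambda>x. x + w) ^^ k) y"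
    using assms
  proof induction
    case (base f)
    then show ?case by (intro exI[of _ 0] exI[of _ f]) (auto intro: translation_closure.base)
  next
    case (step x u)
    then obtain k y where y: "y \<in> translation_closure W F" "x = ((\<lambda>x. x + w) ^^ k) y" by blast
    show ?case
    proof (cases "u = w")
      case True
      with y show ?thesis by (intro exI[of _ "Suc k"] exI[of _ y]) auto
    next
      case False
      with step y show ?thesis
        by (intro exI[of _ k] exI[of _ "y + u"])
          (auto simp: funpow_translation_add intro: translation_closure.step)
    qed
  qed
  then show ?thesis using that by blast
qed

lemma funpow_translation_closure:
  assumes "x \<in> translation_closure W F" "w \<in> W"
  shows "((\<lambda>x. x + w) ^^ k) x \<in> translation_closure W F"
  using assms by (induction k) (auto intro: translation_closure.step)

lemma translation_closure_image_funpow: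
  assumes "x \<in> translation_closure W F"
  shows "((\<lambda>x. x + w) ^^ k) x \<in> translation_closure W (((\<lambda>x. x + w) ^^ k) ` F)"
  using assms
  by induction (auto simp: funpow_translation_add intro: translation_closure.intros)

text \<open>A form of Dickson's lemma: the sets of elements that enter \<open>A\<close> after \<open>k\<close> translations by the
  last generator increase with \<open>k\<close> and therefore stabilise.\<close>

lemma finitely_generated_translation_closed:
  fixes W F A :: "'a::ab_semigroup_add set"
  assumes "finite W" "finite F" "A \<subseteq> translation_closure W F"
    "\<And>a w. a \<in> A \<Longrightarrow> w \<in> W \<Longrightarrow> a + w \<in> A"
  shows "\<exists>G. finite G \<and> G \<subseteq> A \<and> A \<subseteq> translation_closure W G"
  using assms(1,3,4)
proof (induction arbitrary: A)
  case empty
  then show ?case using assms(2) finite_subset[of A F] by (intro exI[of _ A]) auto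
next
  case (insert w W)
  let ?T = "\<lambda>k. (\<lambda>x. x + w) ^^ k"
  define B where "B k = {x \<in> translation_closure W F. ?T k x \<in> A}" for k
  have B_closed: "x + u \<in> B k" if "x \<in> B k" "u \<in> W" for x u k
    using that insert.prems(2) unfolding B_def
    by (auto simp: funpow_translation_add intro: translation_closure.step)
  have B_Suc: "B k \<subseteq> B (Suc k)" for k
    using insert.prems(2) unfolding B_def by auto
  have B_mono: "B k \<subseteq> B l" if "k \<le> l" for k l
    using lift_Suc_mono_le[of B, OF B_Suc that] .
  \<comment> \<open>The induction hypothesis is applied to the union of the chain first: each of its
    finitely many generators already lies in some \<open>B k\<close>, and this makes the chain
    stop.\<close>
  have "\<exists>G. finite G \<and> G \<subseteq> (\<Union>k. B k) \<and> (\<Union>k. B k) \<subseteq> translation_closure W G"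
    using B_closed by (intro insert.IH) (auto simp: B_def)
  then obtain G where G: "finite G" "G \<subseteq> (\<Union>k. B k)" "(\<Union>k. B k) \<subseteq> translation_closure W G"
    by blast
  have "\<forall>g\<in>G. \<exists>k. g \<in> B k" using G(2) by blast
  then obtain \<kappa> where \<kappa>: "\<And>g. g \<in> G \<Longrightarrow> g \<in> B (\<kappa> g)" by metis
  \<comment> \<open>The inserted \<open>0\<close> keeps the maximum defined when \<open>G\<close> is
    empty.\<close>
  define K where "K = Max (insert 0 (\<kappa> ` G))"
  have GK: "G \<subseteq> B K"
  proof
    fix g assume g: "g \<in> G"
    then have "\<kappa> g \<le> K" using G(1) unfolding K_def by (intro Max_ge) auto
    then show "g \<in> B K" using \<kappa>[OF g] B_mono by blast
  qed
  have BK: "B k \<subseteq> B K" for k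
  proof
    fix x assume "x \<in> B k"
    then have "x \<in> translation_closure W G" using G(3) by blast
    then show "x \<in> B K" using GK B_closed by (rule translation_closure_least)
  qed
  have "\<exists>H. finite H \<and> H \<subseteq> B k \<and> B k \<subseteq> translation_closure W H" for k
    using B_closed by (intro insert.IH) (auto simp: B_def)
  then obtain H where H: "\<And>k. finite (H k)" "\<And>k. H k \<subseteq> B k"
      "\<And>k. B k \<subseteq> translation_closure W (H k)" by metis
  \<comment> \<open>Only the levels up to \<open>K\<close> contribute generators; those of level
    \<open>k\<close> are carried into \<open>A\<close> by their \<open>k\<close>
    translations.\<close>
  define D where "D = (\<Union>k\<le>K. ?T k ` H k)"
  have gen: "?T k y \<in> translation_closure (insert w W) D" if "k \<le> K" "y \<in> B k" for k y
  proof -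
    have "y \<in> translation_closure W (H k)" using that H(3) by blast
    then have "?T k y \<in> translation_closure W (?T k ` H k)"
      by (rule translation_closure_image_funpow)
    then show ?thesis
      by (rule translation_closure_mono) (use that in \<open>auto simp: D_def\<close>)
  qed
  have "A \<subseteq> translation_closure (insert w W) D"
  proof
    fix x assume x: "x \<in> A"
    obtain k y where y: "y \<in> translation_closure W F" "x = ?T k y"
      by (rule translation_closure_insertE[OF subsetD[OF insert.prems(1) x]])
    have yk: "y \<in> B k" using x y unfolding B_def by auto
    show "x \<in> translation_closure (insert w W) D"
    proof (cases "k \<le> K")
      case True
      then show ?thesis using gen yk y by auto
    next
      case False
      \<comment> \<open>Past level \<open>K\<close> the chain is constant, so \<open>y\<close>
        enters \<open>A\<close> after \<open>K\<close> translations already; the other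
        \<open>k - K\<close> are translations by the generator \<open>w\<close> of the
        closure.\<close>
      have "?T K y \<in> translation_closure (insert w W) D" using gen yk BK by blast
      then have "?T (k - K) (?T K y) \<in> translation_closure (insert w W) D"
        by (rule funpow_translation_closure) auto
      moreover have "?T (k - K) (?T K y) = x"
        using False y by (metis comp_apply funpow_add le_add_diff_inverse2 nat_le_linear)
      ultimately show ?thesis by simp
    qed
  qed
  moreover have "finite D" using H unfolding D_def by auto
  moreover have "D \<subseteq> A" using H(2) unfolding D_def B_def by blast
  ultimately show ?case by blast
qed

section \<open>Hilbert series of translation-closed sets\<close>

definition level_series :: "('a \<Rightarrow> nat) \<Rightarrow> 'a set \<Rightarrow> int fps" where
  "level_series deg A = Abs_fps (\<lambda>n. int (card {a \<in> A. deg a = n}))"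

lemma level_series_Diff:
  assumes "B \<subseteq> A" "\<And>n. finite {a \<in> A. deg a = n}"
  shows "level_series deg (A - B) = level_series deg A - level_series deg B"
proof (rule fps_ext)
  fix n
  have "{a \<in> A - B. deg a = n} = {a \<in> A. deg a = n} - {a \<in> B. deg a = n}" by auto
  moreover have "{a \<in> B. deg a = n} \<subseteq> {a \<in> A. deg a = n}" using assms(1) by auto
  moreover have "finite {a \<in> B. deg a = n}" "card {a \<in> B. deg a = n} \<le> card {a \<in> A. deg a = n}"
    using calculation(2) assms(2) by (auto intro: finite_subset card_mono)
  ultimately show "level_series deg (A - B) $ n = (level_series deg A - level_series deg B) $ n"
    by (simp add: level_series_def card_Diff_subset of_nat_diff)
qed

lemma level_series_translate:
  fixes A :: "'a::cancel_ab_semigroup_add set"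
  assumes "\<And>x. deg (x + w) = deg x + q"
  shows "level_series deg ((\<lambda>x. x + w) ` A) = fps_X ^ q * level_series deg A"
proof (rule fps_ext)
  fix n
  show "level_series deg ((\<lambda>x. x + w) ` A) $ n = (fps_X ^ q * level_series deg A) $ n"
  proof (cases "n < q")
    case True
    then have "{a \<in> (\<lambda>x. x + w) ` A. deg a = n} = {}" using assms by auto
    then have "card {a \<in> (\<lambda>x. x + w) ` A. deg a = n} = 0" by (metis card.empty)
    then show ?thesis using True by (simp add: level_series_def fps_X_power_mult_nth)
  next
    case False
    then have "{a \<in> (\<lambda>x. x + w) ` A. deg a = n} = (\<lambda>x. x + w) ` {a \<in> A. deg a = n - q}"
      using assms by auto
    moreover have "inj_on (\<lambda>x. x + w) {a \<in> A. deg a = n - q}" by (auto simp: inj_on_def)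
    ultimately have "card {a \<in> (\<lambda>x. x + w) ` A. deg a = n} = card {a \<in> A. deg a = n - q}"
      by (simp add: card_image)
    then show ?thesis using False by (simp add: level_series_def fps_X_power_mult_nth)
  qed
qed

text \<open>Turns polynomiality into a condition on coefficients, which is the form that the
  finiteness and growth arguments can handle.\<close>

lemma fps_of_poly_eventually_zero:
  fixes f :: "'a::comm_ring_1 fps"
  shows "(\<exists>p. f = fps_of_poly p) \<longleftrightarrow> (\<exists>N. \<forall>n\<ge>N. f $ n = 0)"
proof
  assume "\<exists>p. f = fps_of_poly p"
  then obtain p where "f = fps_of_poly p" by blast
  then show "\<exists>N. \<forall>n\<ge>N. f $ n = 0"
    by (intro exI[of _ "Suc (degree p)"]) (auto simp: coeff_eq_0)
next
  assume "\<exists>N. \<forall>n\<ge>N. f $ n = 0"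
  then obtain N where N: "\<And>n. n \<ge> N \<Longrightarrow> f $ n = 0" by blast
  have "coeff (Abs_poly (fps_nth f)) = fps_nth f"
    by (rule coeff_Abs_poly[of N]) (use N in auto)
  then have "f = fps_of_poly (Abs_poly (fps_nth f))" by (intro fps_ext) simp
  then show "\<exists>p. f = fps_of_poly p" ..
qed

text \<open>The Hilbert--Serre argument for monomial modules: dividing out one generator \<open>w\<close> leaves
  \<open>A - (A + w)\<close>, which is the difference of two sets closed under the remaining generators.\<close>

lemma level_series_rational:
  fixes W F A :: "'a::cancel_ab_semigroup_add set"
  assumes "finite W" "\<And>w x. w \<in> W \<Longrightarrow> deg (x + w) = deg x + q"
    "finite F" "A \<subseteq> translation_closure W F"
    "\<And>a w. a \<in> A \<Longrightarrow> w \<in> W \<Longrightarrow> a + w \<in> A"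
    "\<And>n. finite {a \<in> A. deg a = n}"
  shows "\<exists>p. (1 - fps_X ^ q) ^ card W * level_series deg A = fps_of_poly p"
  using assms
proof (induction arbitrary: A F)
  case empty
  then have "finite A" using finite_subset by auto
  then have "level_series deg A $ n = 0" if "n \<ge> Suc (Max (deg ` A))" for n
  proof -
    have "{a \<in> A. deg a = n} = {}" using that Max_ge[of "deg ` A"] \<open>finite A\<close>
      by (fastforce simp: Suc_le_eq)
    then show ?thesis by (simp only: level_series_def fps_nth_Abs_fps card.empty of_nat_0)
  qed
  then have "\<exists>p. level_series deg A = fps_of_poly p"
    using fps_of_poly_eventually_zero by blast
  then show ?case by simp
next
  case (insert w W)
  \<comment> \<open>The given \<open>F\<close> may lie outside \<open>A\<close>. Generators inside
    \<open>A\<close> are needed so that the closure \<open>U\<close> under the remaining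
    translations stays within \<open>A\<close>.\<close>
  obtain G where G: "finite G" "G \<subseteq> A" "A \<subseteq> translation_closure (insert w W) G"
    using finitely_generated_translation_closed[of "insert w W" F A] insert by auto
  define U where "U = translation_closure W G"
  define B where "B = (\<lambda>x. x + w) ` A"
  have UA: "U \<subseteq> A"
    using translation_closure_least[of _ W G A] G(2) insert.prems unfolding U_def by blast
  have BA: "B \<subseteq> A" using insert.prems unfolding B_def by auto
  \<comment> \<open>If the representation of \<open>x\<close> used \<open>w\<close> at all, undoing
    one translation would leave an element of \<open>A\<close> and put \<open>x\<close> into
    \<open>B\<close>.\<close>
  have "x \<in> U" if x: "x \<in> A" "x \<notin> B" for x
  proof -
    obtain k y where y: "y \<in> U" "x = ((\<lambda>x. x + w) ^^ k) y"
      unfolding U_def by (rule translation_closure_insertE[OF subsetD[OF G(3) x(1)]])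
    show ?thesis
    proof (cases k)
      case 0
      with y show ?thesis by simp
    next
      case (Suc l)
      have "((\<lambda>x. x + w) ^^ l) y \<in> A"
        using y(1) UA insert.prems(4) by (induction l) auto
      then show ?thesis using x y Suc unfolding B_def by auto
    qed
  qed
  then have eq: "A - B = U - U \<inter> B" using UA by auto
  have finU: "finite {a \<in> U. deg a = n}" for n
    by (rule finite_subset[OF _ insert.prems(5)[of n]]) (use UA in auto)
  have finUB: "finite {a \<in> U \<inter> B. deg a = n}" for n
    by (rule finite_subset[OF _ finU[of n]]) auto
  have Uclosed: "a + u \<in> U" if "a \<in> U" "u \<in> W" for a u
    using that unfolding U_def by (auto intro: translation_closure.step)
  have Bclosed: "a + u \<in> B" if au: "a \<in> B" "u \<in> W" for a u
  proof -
    obtain b where "b \<in> A" "a = b + w" using au(1) unfolding B_def by auto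
    then have "a + u = (b + u) + w" "b + u \<in> A" using au insert.prems by (auto simp: ac_simps)
    then show ?thesis unfolding B_def by blast
  qed
  have degW: "deg (x + u) = deg x + q" if "u \<in> W" for x u using that insert.prems(1) by blast
  obtain p1 where p1: "(1 - fps_X ^ q) ^ card W * level_series deg U = fps_of_poly p1"
    using insert.IH[of G U] degW G Uclosed finU unfolding U_def by blast
  \<comment> \<open>Here \<open>G\<close> need not be contained in \<open>U \<inter> B\<close>;
    lying inside the closure of a finite set is all that the induction hypothesis asks.\<close>
  obtain p2 where p2: "(1 - fps_X ^ q) ^ card W * level_series deg (U \<inter> B) = fps_of_poly p2"
    using insert.IH[of G "U \<inter> B"] degW G Uclosed Bclosed finUB unfolding U_def by blast
  have "(1 - fps_X ^ q) * level_series deg A = level_series deg A - level_series deg B"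
    using level_series_translate[of deg w q A] insert.prems(1) unfolding B_def
    by (simp add: algebra_simps)
  also have "\<dots> = level_series deg (A - B)"
    using level_series_Diff[OF BA insert.prems(5)] by simp
  also have "\<dots> = level_series deg U - level_series deg (U \<inter> B)"
    unfolding eq by (rule level_series_Diff) (use finU in auto)
  finally have *: "(1 - fps_X ^ q) * level_series deg A =
      level_series deg U - level_series deg (U \<inter> B)" .
  have "(1 - fps_X ^ q) ^ card (insert w W) * level_series deg A =
      (1 - fps_X ^ q) ^ card W * ((1 - fps_X ^ q) * level_series deg A)"
    using insert.hyps by (simp add: algebra_simps)
  also have "\<dots> = fps_of_poly (p1 - p2)"
    unfolding * by (simp add: right_diff_distrib p1 p2 fps_of_poly_diff)
  finally show ?case by blast
qed

section \<open>Coefficient growth and the order of the pole\<close>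

lemma power_Suc_diff_le:
  assumes "n \<ge> 1"
  shows "(real n + 1) ^ Suc j - real n ^ Suc j \<le> real (Suc j) * 2 ^ j * real n ^ j"
proof -
  have "(real n + 1) ^ Suc j - real n ^ Suc j = (\<Sum>p<Suc j. (real n + 1) ^ p * real n ^ (j - p))"
    using power_diff_sumr2[of "real n + 1" "Suc j" "real n"] by (simp add: mult.commute)
  also have "\<dots> \<le> (\<Sum>p<Suc j. 2 ^ j * real n ^ j)"
  proof (rule sum_mono)
    fix p assume p: "p \<in> {..<Suc j}"
    \<comment> \<open>Since \<open>n \<ge> 1\<close>, both \<open>n + 1\<close> and \<open>n\<close>
      are at most \<open>2 * n\<close>.\<close>
    have "(real n + 1) ^ p * real n ^ (j - p) \<le> (2 * real n) ^ p * (2 * real n) ^ (j - p)"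
      using assms by (intro mult_mono power_mono) auto
    also have "\<dots> = (2 * real n) ^ j"
      using p by (subst power_add[symmetric]) auto
    finally show "(real n + 1) ^ p * real n ^ (j - p) \<le> 2 ^ j * real n ^ j"
      by (simp add: power_mult_distrib)
  qed
  also have "\<dots> = real (Suc j) * 2 ^ j * real n ^ j" by simp
  finally show ?thesis .
qed

text \<open>Discrete integration: summing increments of order \<open>n ^ j\<close> raises the order
  by one.\<close>

lemma difference_growth:
  fixes a :: "nat \<Rightarrow> real"
  assumes "c > 0" "\<And>n. n \<ge> N \<Longrightarrow> a (Suc n) - a n \<ge> c * real n ^ j"
  shows "\<exists>c'>0. \<exists>N'. \<forall>n\<ge>N'. a n \<ge> c' * real n ^ Suc j"
proof -
  \<comment> \<open>With this constant the increments of \<open>c2 * n ^ Suc j\<close> are at most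
    \<open>c * n ^ j\<close>, by \<open>power_Suc_diff_le\<close>. Starting at \<open>Suc N\<close>
    guarantees \<open>n \<ge> 1\<close> there, and \<open>B\<close> records the offset at the
    start.\<close>
  define c2 where "c2 = c / (real (Suc j) * 2 ^ j)"
  define M where "M = Suc N"
  define B where "B = c2 * real M ^ Suc j - a M"
  have c2: "c2 > 0" using assms(1) by (simp add: c2_def)
  have low: "a n \<ge> c2 * real n ^ Suc j - B" if "n \<ge> M" for n
    using that
  proof (induction rule: dec_induct)
    case base
    show ?case by (simp add: B_def)
  next
    case (step n)
    have "c2 * ((real n + 1) ^ Suc j - real n ^ Suc j) \<le> c2 * (real (Suc j) * 2 ^ j * real n ^ j)"
      using step c2 by (intro mult_left_mono power_Suc_diff_le) (auto simp: M_def)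
    also have "\<dots> = c * real n ^ j" by (simp add: c2_def del: of_nat_Suc)
    also have "\<dots> \<le> a (Suc n) - a n" using step by (intro assms(2)) (auto simp: M_def)
    finally show ?case using step.IH by (simp add: algebra_simps)
  qed
  \<comment> \<open>From here on the offset \<open>B\<close> costs at most half of the leading
    term.\<close>
  define N' where "N' = M + nat \<lceil>2 * \<bar>B\<bar> / c2\<rceil>"
  have "a n \<ge> c2 / 2 * real n ^ Suc j" if n: "n \<ge> N'" for n
  proof -
    have "n \<ge> 1" using n by (auto simp: N'_def M_def)
    have "2 * \<bar>B\<bar> / c2 \<le> real n" using n unfolding N'_def by linarith
    then have "\<bar>B\<bar> \<le> c2 / 2 * real n" using c2 by (simp add: field_simps)
    also have "\<dots> \<le> c2 / 2 * real n ^ Suc j"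
      using c2 \<open>n \<ge> 1\<close> by (intro mult_left_mono) (auto simp: one_le_power)
    finally have "B \<le> c2 / 2 * real n ^ Suc j" by linarith
    moreover have "a n \<ge> c2 * real n ^ Suc j - B" using n by (intro low) (simp add: N'_def)
    ultimately show ?thesis by (simp add: field_simps)
  qed
  then show ?thesis using c2 by (intro exI[of _ "c2 / 2"]) auto
qed

lemma fps_one_minus_X_power_mult_nth:
  fixes f :: "'a::comm_ring_1 fps"
  shows "((1 - fps_X ^ q) * f) $ (n + q) = f $ (n + q) - f $ n"
  by (simp add: left_diff_distrib fps_X_power_mult_nth)

text \<open>Multiplication by \<open>1 - fps_X ^ q\<close> takes differences along a residue class
  modulo \<open>q\<close>, so undoing each factor is one discrete integration. The factor
  \<open>s\<close> is meant as a sign, so that negative coefficients are covered too.\<close>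

lemma fps_difference_growth:
  fixes f :: "int fps" and s :: real
  assumes "c > 0" "\<forall>k\<ge>N. s * real_of_int (((1 - fps_X ^ q) ^ i * f) $ (n + q * k)) \<ge> c * real k ^ l"
  shows "\<exists>c'>0. \<exists>N'. \<forall>k\<ge>N'. s * real_of_int (f $ (n + q * k)) \<ge> c' * real k ^ (l + i)"
  using assms
proof (induction i arbitrary: c N l)
  case 0
  then show ?case by auto
next
  case (Suc i)
  let ?g = "(1 - fps_X ^ q) ^ i * f"
  have diff: "s * real_of_int (?g $ (n + q * Suc k)) - s * real_of_int (?g $ (n + q * k)) \<ge> c * real k ^ l"
    if "k \<ge> N" for k
  proof -
    have "c * real k ^ l \<le> c * real (Suc k) ^ l"
      using Suc.prems(1) by (intro mult_left_mono power_mono) auto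
    also have "\<dots> \<le> s * real_of_int (((1 - fps_X ^ q) ^ Suc i * f) $ (n + q * Suc k))"
      using Suc.prems(2) that by (meson le_SucI)
    also have "((1 - fps_X ^ q) ^ Suc i * f) $ (n + q * Suc k) = ?g $ (n + q * Suc k) - ?g $ (n + q * k)"
      using fps_one_minus_X_power_mult_nth[of q ?g "n + q * k"] by (simp add: ac_simps)
    finally show ?thesis by (simp add: algebra_simps)
  qed
  have "\<exists>c'>0. \<exists>N'. \<forall>k\<ge>N'. s * real_of_int (?g $ (n + q * k)) \<ge> c' * real k ^ Suc l"
    by (rule difference_growth[OF Suc.prems(1)]) (erule diff)
  then obtain c' N' where "c' > 0"
      "\<forall>k\<ge>N'. s * real_of_int (?g $ (n + q * k)) \<ge> c' * real k ^ Suc l" by blast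
  from Suc.IH[OF this] show ?case by simp
qed

text \<open>Surplus factors are removed one at a time. If one could not be removed, the product
  without it would be a nonzero constant along some residue class far out; integrating
  \<open>d + j\<close> times makes \<open>f\<close> grow like \<open>k ^ (d + j)\<close> there,
  against the bound of order \<open>d - 1\<close>.\<close>

lemma fps_pole_order_le_growth:
  fixes f :: "int fps"
  assumes "q > 0" "d > 0" "\<And>n. real_of_int \<bar>f $ n\<bar> \<le> C * (real n + 1) ^ (d - 1)"
    "\<exists>p. (1 - fps_X ^ q) ^ (d + j) * f = fps_of_poly p"
  shows "\<exists>p. (1 - fps_X ^ q) ^ d * f = fps_of_poly p"
  using assms(4)
proof (induction j)
  case 0
  then show ?case by simp
next
  case (Suc j)
  let ?h = "(1 - fps_X ^ q) ^ (d + j) * f"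
  have "\<exists>p. (1 - fps_X ^ q) * ?h = fps_of_poly p"
    using Suc.prems by (simp add: mult.assoc)
  then obtain N where N: "\<And>n. n \<ge> N \<Longrightarrow> ((1 - fps_X ^ q) * ?h) $ n = 0"
    using fps_of_poly_eventually_zero by blast
  have "?h $ n = 0" if n: "n \<ge> N" for n
  proof (rule ccontr)
    assume nz: "?h $ n \<noteq> 0"
    define s where "s = real_of_int (sgn (?h $ n))"
    have const: "?h $ (n + q * k) = ?h $ n" for k
    proof (induction k)
      case (Suc k)
      have "((1 - fps_X ^ q) * ?h) $ ((n + q * k) + q) = 0" using n by (intro N) auto
      then have "?h $ ((n + q * k) + q) = ?h $ (n + q * k)"
        unfolding fps_one_minus_X_power_mult_nth by simp
      then show ?case using Suc by (simp add: ac_simps)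
    qed auto
    have "s * real_of_int (?h $ (n + q * k)) = real_of_int \<bar>?h $ n\<bar>" for k
      unfolding const s_def by (simp flip: of_int_mult of_int_abs add: abs_sgn mult.commute)
    then have "\<forall>k\<ge>0. s * real_of_int (?h $ (n + q * k)) \<ge> real_of_int \<bar>?h $ n\<bar> * real k ^ 0" by simp
    from fps_difference_growth[OF _ this] nz
    obtain c N' where c: "c > 0" and
      low: "\<And>k. k \<ge> N' \<Longrightarrow> s * real_of_int (f $ (n + q * k)) \<ge> c * real k ^ (d + j)" by auto
    \<comment> \<open>Comes from \<open>n + q * k + 1 \<le> 2 * (n + q + 1) * k\<close> for
      \<open>k \<ge> 1\<close>, raised to the power \<open>d - 1\<close>.\<close>
    define D where "D = \<bar>C\<bar> * (2 * (real n + real q + 1)) ^ (d - 1)"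
    have up: "s * real_of_int (f $ (n + q * k)) \<le> D * real k ^ (d - 1)" if "k \<ge> 1" for k
    proof -
      have "s * real_of_int (f $ (n + q * k)) \<le> \<bar>s * real_of_int (f $ (n + q * k))\<bar>" by simp
      also have "\<dots> \<le> real_of_int \<bar>f $ (n + q * k)\<bar>"
        by (auto simp: abs_mult s_def sgn_if)
      also have "\<dots> \<le> C * (real (n + q * k) + 1) ^ (d - 1)" by (rule assms(3))
      also have "\<dots> \<le> \<bar>C\<bar> * (2 * (real n + real q + 1) * real k) ^ (d - 1)"
      proof (intro mult_mono power_mono)
        have "real n \<le> real n * real k" using that by (simp add: mult_le_cancel_left1)
        moreover have "0 \<le> real q * real k" "1 \<le> real k" using that by auto
        ultimately show "real (n + q * k) + 1 \<le> 2 * (real n + real q + 1) * real k"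
          by (simp only: of_nat_add of_nat_mult ring_distribs mult_1 mult.assoc)
      qed auto
      also have "\<dots> = D * real k ^ (d - 1)" by (simp add: D_def power_mult_distrib)
      finally show ?thesis .
    qed
    \<comment> \<open>Beyond \<open>D / c\<close> the lower bound overtakes
      \<open>D * k ^ (d - 1)\<close>.\<close>
    define k where "k = Suc (N' + nat \<lceil>D / c\<rceil>)"
    have k: "k \<ge> N'" "k \<ge> 1" "D / c < real k" unfolding k_def by linarith+
    have "real k ^ (d - 1) > 0" using k by simp
    have "D < c * real k" using k(3) c by (simp add: field_simps)
    have "D * real k ^ (d - 1) < c * real k * real k ^ (d - 1)"
      using \<open>D < c * real k\<close> \<open>real k ^ (d - 1) > 0\<close> by (rule mult_strict_right_mono)
    also have "\<dots> = c * real k ^ d" using assms(2) by (cases d) auto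
    also have "\<dots> \<le> c * real k ^ (d + j)"
      using c k by (intro mult_left_mono power_increasing) auto
    also have "\<dots> \<le> D * real k ^ (d - 1)" using low up k by (meson order_trans)
    finally show False by simp
  qed
  then have "\<exists>p. ?h = fps_of_poly p" using fps_of_poly_eventually_zero by blast
  then show ?case by (rule Suc.IH)
qed

section \<open>Counting lattice points in bounded sets and on hyperplanes\<close>

lemma lattice_points_add: "x \<in> lattice_points \<Longrightarrow> y \<in> lattice_points \<Longrightarrow> x + y \<in> lattice_points"
  by (simp add: lattice_points_def)

lemma lattice_points_diff: "x \<in> lattice_points \<Longrightarrow> y \<in> lattice_points \<Longrightarrow> x - y \<in> lattice_points"
  by (simp add: lattice_points_def)

lemma inner_lattice_points: "x \<in> lattice_points \<Longrightarrow> y \<in> lattice_points \<Longrightarrow> x \<bullet> y \<in> \<int>"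
  by (auto simp: lattice_points_def inner_vec_def intro!: Ints_sum)

lemma bounded_finite_lattice_points:
  fixes S :: "(real ^ 'd) set"
  assumes "bounded S"
  shows "finite (S \<inter> lattice_points)"
proof -
  obtain R where R: "\<And>x. x \<in> S \<Longrightarrow> norm x \<le> R" using assms bounded_iff by blast
  define D where "D = {y :: real \<in> \<int>. \<bar>y\<bar> \<le> R}"
  have "finite (vec_lambda ` (UNIV \<rightarrow>\<^sub>E D) :: (real ^ 'd) set)"
    unfolding D_def by (intro finite_imageI finite_PiE finite_abs_int_segment) auto
  then show ?thesis
  proof (rule finite_subset[rotated], intro subsetI)
    fix x assume "x \<in> S \<inter> lattice_points"
    then have "x $ i \<in> D" for i unfolding D_def lattice_points_def
      using R component_le_norm_cart[of x i] by (auto intro: order_trans)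
    then show "x \<in> vec_lambda ` (UNIV \<rightarrow>\<^sub>E D)"
      by (intro image_eqI[of _ _ "vec_nth x"]) auto
  qed
qed

text \<open>A coordinate \<open>i\<close> with \<open>a $ i \<noteq> 0\<close> is determined by the
  others, so forgetting it is injective. This saves one power compared with the whole box.\<close>

lemma card_lattice_points_hyperplane_le:
  fixes a :: "real ^ 'd" and R :: nat and t :: real
  assumes "a \<noteq> 0"
  defines "S \<equiv> {x \<in> lattice_points. (\<forall>i. \<bar>x $ i\<bar> \<le> real R) \<and> a \<bullet> x = t}"
  shows "finite S \<and> card S \<le> (2 * R + 1) ^ (CARD('d) - 1)"
proof -
  obtain i where i: "a $ i \<noteq> 0" using assms(1) by (auto simp: vec_eq_iff)
  define D where "D = {y :: real \<in> \<int>. \<bar>y\<bar> \<le> real R}"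
  have "D = real_of_int ` {- int R..int R}"
  proof -
    have "y \<in> real_of_int ` {- int R..int R}" if "y \<in> D" for y
      using that unfolding D_def by (elim CollectE conjE Ints_cases) (auto intro!: imageI)
    then show ?thesis unfolding D_def by auto
  qed
  then have D: "finite D" "card D = 2 * R + 1"
    by (auto simp: card_image inj_on_def)
  define f where "f x = restrict (vec_nth x) (- {i})" for x :: "real ^ 'd"
  have inj: "inj_on f S"
  proof (rule inj_onI)
    fix x y assume xy: "x \<in> S" "y \<in> S" "f x = f y"
    have off: "x $ j = y $ j" if "j \<noteq> i" for j
      using fun_cong[OF xy(3), of j] that by (simp add: f_def)
    have "0 = a \<bullet> (x - y)" using xy by (simp add: S_def inner_diff_right)
    also have "\<dots> = (\<Sum>j\<in>UNIV. a $ j * (x $ j - y $ j))" by (simp add: inner_vec_def)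
    also have "\<dots> = (\<Sum>j\<in>{i}. a $ j * (x $ j - y $ j))"
      by (rule sum.mono_neutral_right) (use off in auto)
    finally have "x $ i = y $ i" using i by simp
    with off show "x = y" by (metis vec_eq_iff)
  qed
  have sub: "f ` S \<subseteq> (- {i}) \<rightarrow>\<^sub>E D"
    by (auto simp: f_def S_def D_def lattice_points_def)
  have fin: "finite ((- {i}) \<rightarrow>\<^sub>E D)" using D by (intro finite_PiE) auto
  have "card S \<le> card ((- {i}) \<rightarrow>\<^sub>E D)" using card_inj_on_le[OF inj sub fin] .
  also have "\<dots> = (2 * R + 1) ^ (CARD('d) - 1)" using D by (simp add: card_PiE card_Diff_subset Compl_eq_Diff_UNIV)
  finally show ?thesis using inj_on_finite[OF inj sub fin] by blast
qed

section \<open>Dilates of a polytope and rationality of its Ehrhart series\<close>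

lemma dilate_0: "P \<noteq> {} \<Longrightarrow> dilate 0 P = {0}"
  by (auto simp: dilate_def)

lemma bounded_dilate: "bounded P \<Longrightarrow> bounded (dilate n P)"
  unfolding dilate_def by (rule bounded_scaling)

text \<open>The sum is \<open>n + q\<close> times a weighted mean with weights proportional to
  \<open>n\<close> and \<open>q\<close>; \<open>q > 0\<close> keeps the weights meaningful at
  \<open>n = 0\<close>.\<close>

lemma dilate_add:
  fixes P :: "(real ^ 'd) set"
  assumes "convex P" "q > 0" "x \<in> dilate n P" "y \<in> dilate q P"
  shows "x + y \<in> dilate (n + q) P"
proof -
  obtain u v where u: "u \<in> P" "x = real n *\<^sub>R u" and v: "v \<in> P" "y = real q *\<^sub>R v"
    using assms by (auto simp: dilate_def)
  define w where "w = (real n / real (n + q)) *\<^sub>R u + (real q / real (n + q)) *\<^sub>R v"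
  have "real n / real (n + q) + real q / real (n + q) = 1"
    using assms(2) by (simp flip: add_divide_distrib)
  then have "w \<in> P" unfolding w_def
    by (intro convexD[OF assms(1) u(1) v(1)]) auto
  moreover have "x + y = real (n + q) *\<^sub>R w"
    using assms(2) unfolding w_def u v by (simp add: scaleR_add_right)
  ultimately show ?thesis unfolding dilate_def by blast
qed

text \<open>In a convex combination of the vertices with total weight \<open>n / q > card V\<close> some weight is
  at least 1.\<close>

lemma dilate_descent:
  fixes P :: "(real ^ 'd) set"
  assumes "finite V" "q > 0" "dilate q P = convex hull V" "n > q * card V" "x \<in> dilate n P"
  shows "\<exists>v\<in>V. x - v \<in> dilate (n - q) P"
proof -
  obtain y where y: "y \<in> P" "x = real n *\<^sub>R y"
    using assms(5) unfolding dilate_def by blast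
  have "real q *\<^sub>R y \<in> dilate q P" using y(1) unfolding dilate_def by blast
  then have "real q *\<^sub>R y \<in> convex hull V" by (simp only: assms(3))
  then obtain u where u: "\<And>v. v \<in> V \<Longrightarrow> 0 \<le> u v" "sum u V = 1" "(\<Sum>v\<in>V. u v *\<^sub>R v) = real q *\<^sub>R y"
    unfolding convex_hull_finite[OF assms(1)] by blast
  define l where "l v = real n / real q * u v" for v
  have "sum l V = real n / real q * sum u V"
    unfolding l_def by (rule sum_distrib_left[symmetric])
  then have lsum: "sum l V = real n / real q" using u(2) by simp
  have lx: "(\<Sum>v\<in>V. l v *\<^sub>R v) = x"
  proof -
    have "(\<Sum>v\<in>V. l v *\<^sub>R v) = (real n / real q) *\<^sub>R (\<Sum>v\<in>V. u v *\<^sub>R v)"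
      by (simp add: l_def scaleR_sum_right)
    then show ?thesis using u(3) y(2) assms(2) by simp
  qed
  have "\<exists>v\<in>V. l v \<ge> 1"
  proof (rule ccontr)
    assume "\<not> ?thesis"
    then have "sum l V \<le> (\<Sum>v\<in>V. 1)" by (intro sum_mono) auto
    then have "real n \<le> real (q * card V)" using assms(2) lsum by (simp add: field_simps)
    then show False using assms(4) by linarith
  qed
  then obtain v where v: "v \<in> V" "l v \<ge> 1" by blast
  \<comment> \<open>This secures \<open>q < n\<close>, so that \<open>n - q\<close> is a genuine
    subtraction.\<close>
  then have "card V \<ge> 1" using assms(1) by (auto simp: Suc_le_eq card_gt_0_iff)
  then have "q * 1 \<le> q * card V" by (rule mult_left_mono) simp
  then have nq: "n > q" using assms(4) by linarith
  \<comment> \<open>Taking \<open>v\<close> away once leaves nonnegative weights of sum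
    \<open>n / q - 1\<close>; the factor \<open>c\<close> is the reciprocal of that sum and restores
    a convex combination.\<close>
  define m where "m w = l w - (if w = v then 1 else 0)" for w
  define c where "c = real q / real (n - q)"
  have c: "c > 0" using nq assms(2) by (simp add: c_def)
  have "sum m V = real n / real q - 1"
    using lsum v(1) assms(1) by (simp add: m_def sum_subtractf)
  also have "\<dots> = 1 / c" using nq assms(2) by (simp add: c_def of_nat_diff field_simps)
  finally have "c * sum m V = 1" using c by simp
  then have "(\<Sum>w\<in>V. c * m w) = 1" by (simp only: sum_distrib_left)
  moreover have "0 \<le> c * m w" if "w \<in> V" for w
    using v u(1)[OF that] c unfolding m_def by (auto simp: l_def)
  ultimately have "(\<Sum>w\<in>V. (c * m w) *\<^sub>R w) \<in> convex hull V"
    unfolding convex_hull_finite[OF assms(1)] by (intro CollectI exI[of _ "\<lambda>w. c * m w"]) simp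
  moreover have "(\<Sum>w\<in>V. m w *\<^sub>R w) = x - v"
  proof -
    have "(\<Sum>w\<in>V. m w *\<^sub>R w) = (\<Sum>w\<in>V. l w *\<^sub>R w - (if w = v then w else 0))"
      by (intro sum.cong) (auto simp: m_def scaleR_diff_left)
    also have "\<dots> = x - v" using lx v(1) assms(1) by (simp add: sum_subtractf)
    finally show ?thesis .
  qed
  then have "(\<Sum>w\<in>V. (c * m w) *\<^sub>R w) = c *\<^sub>R (x - v)"
    unfolding scaleR_scaleR[symmetric] scaleR_sum_right[symmetric] by simp
  ultimately have "c *\<^sub>R (x - v) \<in> dilate q P" by (simp only: assms(3))
  then obtain z where z: "z \<in> P" "c *\<^sub>R (x - v) = real q *\<^sub>R z"
    unfolding dilate_def by blast
  have "x - v = (1 / c) *\<^sub>R (c *\<^sub>R (x - v))" using c by simp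
  also have "\<dots> = real (n - q) *\<^sub>R z" using z(2) assms(2) by (simp add: c_def)
  finally have "x - v \<in> dilate (n - q) P" using z(1) unfolding dilate_def by blast
  then show ?thesis using v(1) by blast
qed

text \<open>The lattice points of the cone over \<open>P\<close> are coded as pairs of a point and
  its height. By \<open>dilate_descent\<close> those of height at most \<open>q * card V\<close>
  generate the rest under translation by the points of \<open>V\<close> placed at height
  \<open>q\<close>. The exponent obtained is the number of these translations, with no relation to
  the dimension yet.\<close>

lemma ehrhart_series_rational:
  fixes P :: "(real ^ 'd) set"
  assumes "finite V" "V \<subseteq> lattice_points" "q > 0" "dilate q P = convex hull V"
    "convex P" "bounded P" "P \<noteq> {}"
  shows "\<exists>m p. (1 - fps_X ^ q) ^ m * ehrhart_series P = fps_of_poly p"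
proof -
  define S where "S = {(x, n). x \<in> dilate n P \<inter> lattice_points}"
  define W where "W = (\<lambda>v. (v, q)) ` V"
  define F where "F = {s \<in> S. snd s \<le> q * card V}"
  have level: "{s \<in> S. snd s = n} = (\<lambda>x. (x, n)) ` (dilate n P \<inter> lattice_points)" for n
    by (auto simp: S_def)
  have fin: "finite {s \<in> S. snd s = n}" for n
    unfolding level by (intro finite_imageI bounded_finite_lattice_points bounded_dilate assms)
  have "F = (\<Union>n\<le>q * card V. {s \<in> S. snd s = n})" by (auto simp: F_def)
  then have finF: "finite F" using fin by simp
  have V: "v \<in> dilate q P" if "v \<in> V" for v using assms(4) hull_inc[OF that] by simp
  have Vl: "v \<in> lattice_points" if "v \<in> V" for v using assms(2) that by blast
  have closed: "s + w \<in> S" if sw: "s \<in> S" "w \<in> W" for s w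
  proof -
    obtain x n where s: "s = (x, n)" "x \<in> dilate n P" "x \<in> lattice_points"
      using sw(1) by (auto simp: S_def)
    obtain v where v: "w = (v, q)" "v \<in> V" using sw(2) by (auto simp: W_def)
    have "x + v \<in> dilate (n + q) P" by (rule dilate_add[OF assms(5,3) s(2) V[OF v(2)]])
    moreover have "x + v \<in> lattice_points" by (rule lattice_points_add[OF s(3) Vl[OF v(2)]])
    ultimately show ?thesis by (simp add: S_def s(1) v(1))
  qed
  have "(x, n) \<in> translation_closure W F" if "(x, n) \<in> S" for x n
    using that
  proof (induction n arbitrary: x rule: less_induct)
    case (less n)
    show ?case
    proof (cases "n \<le> q * card V")
      case True
      with less.prems show ?thesis by (auto simp: F_def intro: translation_closure.base)
    next
      case False
      then obtain v where v: "v \<in> V" "x - v \<in> dilate (n - q) P"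
        using dilate_descent[OF assms(1,3,4), of n x] less.prems by (auto simp: S_def)
      have "card V > 0" using v assms(1) by (auto simp: card_gt_0_iff)
      then have "q * 1 \<le> q * card V" by (intro mult_left_mono) auto
      then have "q < n" using False by linarith
      have "(x - v, n - q) \<in> S"
        using v less.prems by (auto simp: S_def intro: lattice_points_diff Vl)
      then have "(x - v, n - q) \<in> translation_closure W F"
        using less.IH \<open>q < n\<close> assms(3) by auto
      then have "(x - v, n - q) + (v, q) \<in> translation_closure W F"
        by (rule translation_closure.step) (use v in \<open>auto simp: W_def\<close>)
      then show ?thesis using \<open>q < n\<close> by simp
    qed
  qed
  then have gen: "S \<subseteq> translation_closure W F" by auto
  have "finite W" using assms(1) by (simp add: W_def)
  moreover have "snd (s + w) = snd s + q" if "w \<in> W" for w s using that by (auto simp: W_def)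
  ultimately have "\<exists>p. (1 - fps_X ^ q) ^ card W * level_series snd S = fps_of_poly p"
    using level_series_rational[of W snd q F S] finF gen closed fin by blast
  moreover have "level_series snd S = ehrhart_series P"
  proof (rule fps_ext)
    fix n
    have "card {s \<in> S. snd s = n} = card (dilate n P \<inter> lattice_points)"
      unfolding level by (rule card_image) (auto simp: inj_on_def)
    \<comment> \<open>At height 0 the count is 1, which agrees with the constant term prescribed for
      the Ehrhart series.\<close>
    moreover have "dilate 0 P \<inter> lattice_points = {0}"
      using dilate_0[OF assms(7)] by (auto simp: lattice_points_def)
    ultimately show "level_series snd S $ n = ehrhart_series P $ n"
      by (auto simp: level_series_def ehrhart_series_def)
  qed
  ultimately show ?thesis by auto
qed

section \<open>Existence of the denominator\<close>

lemma common_denominator: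
  fixes T :: "real set"
  assumes "finite T" "T \<subseteq> \<rat>"
  shows "\<exists>N::nat. N > 0 \<and> (\<forall>t\<in>T. real N * t \<in> \<int>)"
  using assms
proof induction
  case empty
  then show ?case by auto
next
  case (insert t T)
  then obtain N :: nat where N: "N > 0" "\<And>s. s \<in> T \<Longrightarrow> real N * s \<in> \<int>" by auto
  obtain a b where ab: "b > 0" "t = real_of_int a / real_of_int b"
    using insert.prems by (auto elim!: Rats_cases')
  have "real (N * nat b) * s \<in> \<int>" if "s \<in> insert t T" for s
  proof (cases "s = t")
    case True
    then have "real (N * nat b) * s = real_of_int (int N * a)" using ab by simp
    then show ?thesis by (metis Ints_of_int)
  next
    case False
    then have "real (nat b) * (real N * s) \<in> \<int>" using N(2) that Ints_mult[OF Ints_of_nat] by blast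
    then show ?thesis by (simp add: ac_simps)
  qed
  then show ?case using N(1) ab(1) by (intro exI[of _ "N * nat b"]) auto
qed

text \<open>The \<open>LEAST\<close> is attained because a common denominator of all coordinates of
  the spanning points is an admissible dilation factor.\<close>

lemma denominator:
  fixes P :: "(real ^ 'd) set"
  assumes "rational_polytope P"
  shows "denominator P > 0 \<and> lattice_polytope (dilate (denominator P) P)"
proof -
  obtain V where V: "finite V" "V \<subseteq> rational_points" "P = convex hull V"
    using assms by (auto simp: rational_polytope_def)
  have "finite (\<Union>v\<in>V. range (vec_nth v))" using V(1) by auto
  moreover have "(\<Union>v\<in>V. range (vec_nth v)) \<subseteq> \<rat>" using V(2) by (auto simp: rational_points_def)
  ultimately obtain N :: nat where N: "N > 0" "\<forall>t\<in>(\<Union>v\<in>V. range (vec_nth v)). real N * t \<in> \<int>"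
    using common_denominator by blast
  have "dilate N P = convex hull ((\<lambda>x. real N *\<^sub>R x) ` V)"
    by (simp add: V(3) dilate_def convex_hull_scaling)
  moreover have "(\<lambda>x. real N *\<^sub>R x) ` V \<subseteq> lattice_points"
    using N(2) by (auto simp: lattice_points_def)
  ultimately have "0 < N \<and> lattice_polytope (dilate N P)"
    using V(1) N(1) unfolding lattice_polytope_def by blast
  then show ?thesis unfolding denominator_def by (rule LeastI)
qed

section \<open>The halfspace description, the boundary and its lattice points\<close>

lemma dilate_halfspaces:
  fixes P :: "(real ^ 'd) set"
  assumes "bounded P" "P = {x. \<forall>a\<in>A. a \<bullet> x \<le> 1}"
  shows "dilate n P = {x. \<forall>a\<in>A. a \<bullet> x \<le> real n}"
proof (cases "n = 0")
  case False
  have "x \<in> dilate n P" if "\<forall>a\<in>A. a \<bullet> x \<le> real n" for x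
  proof -
    have "(1 / real n) *\<^sub>R x \<in> P" using that False by (auto simp: assms(2) field_simps)
    moreover have "x = real n *\<^sub>R ((1 / real n) *\<^sub>R x)" using False by simp
    ultimately show ?thesis unfolding dilate_def by blast
  qed
  moreover have "a \<bullet> x \<le> real n" if x: "x \<in> dilate n P" and "a \<in> A" for a x
  proof -
    obtain y where "y \<in> P" "x = real n *\<^sub>R y" using x by (auto simp: dilate_def)
    then show ?thesis using that(2) assms(2) mult_left_mono[of "a \<bullet> y" 1 "real n"] by auto
  qed
  ultimately show ?thesis by blast
next
  case True
  \<comment> \<open>For \<open>n = 0\<close> the inequalities describe the recession cone of
    \<open>P\<close>. It is trivial by boundedness: a nonzero element scaled to norm
    \<open>R + 1\<close> would still lie in \<open>P\<close>.\<close>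
  have "x = 0" if "\<forall>a\<in>A. a \<bullet> x \<le> 0" for x
  proof (rule ccontr)
    assume "x \<noteq> 0"
    obtain R where R: "\<And>y. y \<in> P \<Longrightarrow> norm y \<le> R" using assms(1) bounded_iff by blast
    have "(0 :: real ^ 'd) \<in> P" by (simp add: assms(2))
    then have "R \<ge> 0" using R by force
    define c where "c = (R + 1) / norm x"
    have "c > 0" using \<open>x \<noteq> 0\<close> \<open>R \<ge> 0\<close> by (simp add: c_def)
    have "c *\<^sub>R x \<in> P" unfolding assms(2)
    proof (intro CollectI ballI)
      fix a assume "a \<in> A"
      then have "c * (a \<bullet> x) \<le> 0" using that \<open>c > 0\<close> by (intro mult_nonneg_nonpos) auto
      then show "a \<bullet> c *\<^sub>R x \<le> 1" by simp
    qed
    then have "norm (c *\<^sub>R x) \<le> R" by (rule R)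
    moreover have "norm (c *\<^sub>R x) = R + 1" using \<open>x \<noteq> 0\<close> \<open>R \<ge> 0\<close> by (simp add: c_def)
    ultimately show False by simp
  qed
  moreover have "dilate 0 P = {0}" by (rule dilate_0) (auto simp: assms(2) intro!: exI[of _ 0])
  ultimately show ?thesis using True by auto
qed

lemma frontier_halfspaces:
  fixes P :: "(real ^ 'd) set"
  assumes "finite A" "P = {x. \<forall>a\<in>A. a \<bullet> x \<le> 1}"
  shows "frontier P = {x \<in> P. \<exists>a\<in>A. a \<bullet> x = 1}"
proof -
  have "closed (\<Inter>a\<in>A. {x. a \<bullet> x \<le> 1})" by (intro closed_INT ballI closed_halfspace_le)
  moreover have "P = (\<Inter>a\<in>A. {x. a \<bullet> x \<le> 1})" using assms(2) by auto
  ultimately have "closed P" by simp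
  have "open (\<Inter>a\<in>A. {x. a \<bullet> x < 1})" by (intro open_INT assms ballI open_halfspace_lt)
  then have "(\<Inter>a\<in>A. {x. a \<bullet> x < 1}) \<subseteq> interior P"
    by (rule interior_maximal[rotated]) (auto simp: assms(2) intro: less_imp_le)
  moreover have "a \<bullet> x < 1" if "x \<in> interior P" "a \<in> A" for a x
  \<comment> \<open>A zero row is never tight. For any other row the interior of the closed
    halfspace is the open one.\<close>
  proof (cases "a = 0")
    case False
    have "P \<subseteq> {x. a \<bullet> x \<le> 1}" using that assms(2) by auto
    then have "interior P \<subseteq> interior {x. a \<bullet> x \<le> 1}" by (rule interior_mono)
    then show ?thesis using that(1) interior_halfspace_le[OF False] by auto
  qed auto
  ultimately have "interior P = {x. \<forall>a\<in>A. a \<bullet> x < 1}" by auto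
  then have "frontier P = {x \<in> P. \<not> (\<forall>a\<in>A. a \<bullet> x < 1)}"
    unfolding frontier_def closure_closed[OF \<open>closed P\<close>] by auto
  also have "\<dots> = {x \<in> P. \<exists>a\<in>A. a \<bullet> x = 1}"
    unfolding assms(2) by (metis (mono_tags, lifting) less_le mem_Collect_eq order_less_irrefl)
  finally show ?thesis .
qed

lemma dilate_frontier_halfspaces:
  fixes P :: "(real ^ 'd) set"
  assumes "finite A" "P = {x. \<forall>a\<in>A. a \<bullet> x \<le> 1}" "n > 0"
  shows "dilate n (frontier P) = {x \<in> dilate n P. \<exists>a\<in>A. a \<bullet> x = real n}"
proof -
  have "a \<bullet> (real n *\<^sub>R y) = real n \<longleftrightarrow> a \<bullet> y = 1" for a y :: "real ^ 'd"
    using assms(3) by simp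
  then show ?thesis
    unfolding frontier_halfspaces[OF assms(1,2)] dilate_def by blast
qed

text \<open>Reflexivity enters here: an integral \<open>x\<close> in \<open>n P\<close> with \<open>a \<bullet> x < n\<close> for all integral rows
  \<open>a\<close> satisfies \<open>a \<bullet> x \<le> n - 1\<close>.\<close>

lemma ehrhart_series_frontier:
  fixes P :: "(real ^ 'd) set"
  assumes "bounded P" "finite A" "A \<subseteq> lattice_points" "P = {x. \<forall>a\<in>A. a \<bullet> x \<le> 1}"
  shows "ehrhart_series (frontier P) = (1 - fps_X) * ehrhart_series P"
proof (rule fps_ext)
  fix n
  have "P \<noteq> {}" by (auto simp: assms(4) intro!: exI[of _ 0])
  let ?E = "\<lambda>n. dilate n P \<inter> lattice_points"
  let ?B = "\<lambda>n. dilate n (frontier P) \<inter> lattice_points"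
  \<comment> \<open>Needed for \<open>n = 1\<close>, where \<open>(n - 1) P\<close> is the origin
    and its count must equal the conventional constant term.\<close>
  have 0: "card (?E 0) = 1"
    using dilate_0[OF \<open>P \<noteq> {}\<close>] by (auto simp: lattice_points_def Int_absorb2)
  show "ehrhart_series (frontier P) $ n = ((1 - fps_X) * ehrhart_series P) $ n"
  proof (cases n)
    case 0
    then show ?thesis by (simp add: ehrhart_series_def)
  next
    case (Suc k)
    have H: "dilate m P = {x. \<forall>a\<in>A. a \<bullet> x \<le> real m}" for m
      by (rule dilate_halfspaces[OF assms(1,4)])
    have fr: "dilate n (frontier P) = {x \<in> dilate n P. \<exists>a\<in>A. a \<bullet> x = real n}"
      by (rule dilate_frontier_halfspaces[OF assms(2,4)]) (simp add: Suc)
    have step: "a \<bullet> x \<le> real k \<longleftrightarrow> a \<bullet> x \<le> real n \<and> a \<bullet> x \<noteq> real n"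
      if "a \<in> A" "x \<in> lattice_points" for a x
    proof -
      have "a \<bullet> x \<in> \<int>" using that assms(3) by (intro inner_lattice_points) auto
      then obtain z where z: "a \<bullet> x = of_int z" by (elim Ints_cases)
      have "real n = of_int (int k + 1)" "real k = of_int (int k)" using Suc by auto
      then show ?thesis unfolding z by (simp only: of_int_le_iff of_int_eq_iff) linarith
    qed
    have "?E n = ?B n \<union> ?E k" "?B n \<inter> ?E k = {}"
      unfolding fr H using step by auto
    moreover have "finite (?E k)" "finite (?B n)"
      using bounded_finite_lattice_points[OF bounded_dilate[OF assms(1)]] fr
      by (auto intro: finite_subset[of _ "?E n"])
    ultimately have "card (?E n) = card (?B n) + card (?E k)" by (simp add: card_Un_disjoint)
    then show ?thesis using Suc 0 by (simp add: ehrhart_series_def left_diff_distrib)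
  qed
qed

text \<open>Every boundary point of \<open>n P\<close> lies on a hyperplane
  \<open>a \<bullet> x = n\<close> for one of finitely many rows, inside a box of side proportional
  to \<open>n\<close>; each such hyperplane section has one dimension less than the box.\<close>

lemma ehrhart_series_frontier_growth:
  fixes P :: "(real ^ 'd) set"
  assumes "bounded P" "finite A" "P = {x. \<forall>a\<in>A. a \<bullet> x \<le> 1}"
  shows "\<exists>C. \<forall>n. real_of_int \<bar>ehrhart_series (frontier P) $ n\<bar> \<le> C * (real n + 1) ^ (CARD('d) - 1)"
proof -
  let ?d = "CARD('d) - 1"
  obtain R0 where R0: "\<And>y. y \<in> P \<Longrightarrow> norm y \<le> R0" using assms(1) bounded_iff by blast
  define R where "R = nat \<lceil>R0\<rceil>"
  have R: "norm y \<le> real R" if "y \<in> P" for y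
    using R0[OF that] unfolding R_def by linarith
  \<comment> \<open>The power comes from \<open>2 * R * n + 1 \<le> (2 * R + 1) * (n + 1)\<close>.
    Adding 1 to \<open>card A\<close> gives \<open>C \<ge> 1\<close>, as the constant term requires,
    without an argument that \<open>A\<close> is nonempty.\<close>
  define C where "C = real (card A + 1) * real (2 * R + 1) ^ ?d"
  have "real_of_int \<bar>ehrhart_series (frontier P) $ n\<bar> \<le> C * (real n + 1) ^ ?d" for n
  proof (cases "n = 0")
    case True
    have "1 * 1 \<le> real (card A + 1) * real (2 * R + 1) ^ ?d"
      by (intro mult_mono one_le_power) auto
    then show ?thesis using True by (simp add: ehrhart_series_def C_def)
  next
    case False
    define H where "H a = {x \<in> lattice_points. (\<forall>i. \<bar>x $ i\<bar> \<le> real (R * n)) \<and> a \<bullet> x = real n}"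
      for a :: "real ^ 'd"
    have H: "finite (H a) \<and> card (H a) \<le> (2 * (R * n) + 1) ^ ?d" for a
    \<comment> \<open>The hyperplane bound excludes a zero row, but such a row gives the empty set
      because \<open>n\<close> is positive.\<close>
    proof (cases "a = 0")
      case True
      then have "H a = {}" using False by (auto simp: H_def)
      then show ?thesis by simp
    next
      case False
      then show ?thesis unfolding H_def by (rule card_lattice_points_hyperplane_le)
    qed
    have "dilate n (frontier P) \<inter> lattice_points \<subseteq> (\<Union>a\<in>A. H a)"
    proof
      fix x assume x: "x \<in> dilate n (frontier P) \<inter> lattice_points"
      then obtain a where a: "a \<in> A" "a \<bullet> x = real n" "x \<in> dilate n P"
        using dilate_frontier_halfspaces[OF assms(2,3), of n] False by auto
      then obtain y where y: "y \<in> P" "x = real n *\<^sub>R y" by (auto simp: dilate_def)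
      have "\<bar>x $ i\<bar> \<le> real (R * n)" for i
      proof -
        have "\<bar>x $ i\<bar> \<le> norm x" by (rule component_le_norm_cart)
        also have "\<dots> = real n * norm y" using y by simp
        also have "\<dots> \<le> real n * real R" using R[OF y(1)] by (intro mult_left_mono) auto
        finally show ?thesis by (simp add: mult.commute)
      qed
      then show "x \<in> (\<Union>a\<in>A. H a)" using a x by (auto simp: H_def)
    qed
    then have "card (dilate n (frontier P) \<inter> lattice_points) \<le> card (\<Union>a\<in>A. H a)"
      using H assms(2) by (intro card_mono) auto
    also have "\<dots> \<le> (\<Sum>a\<in>A. card (H a))" by (rule card_UN_le[OF assms(2)])
    also have "\<dots> \<le> (\<Sum>a\<in>A. (2 * (R * n) + 1) ^ ?d)" using H by (intro sum_mono) auto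
    also have "\<dots> = card A * (2 * (R * n) + 1) ^ ?d" by simp
    also have "\<dots> \<le> (card A + 1) * ((2 * R + 1) * (n + 1)) ^ ?d"
      by (intro mult_mono power_mono) (auto simp: algebra_simps)
    finally have "real (card (dilate n (frontier P) \<inter> lattice_points)) \<le>
        real ((card A + 1) * ((2 * R + 1) * (n + 1)) ^ ?d)" by (simp only: of_nat_le_iff)
    also have "\<dots> = C * (real n + 1) ^ ?d"
      by (simp only: C_def of_nat_mult of_nat_power power_mult_distrib of_nat_add of_nat_1 mult.assoc)
    finally show ?thesis using False by (simp add: ehrhart_series_def)
  qed
  then show ?thesis by blast
qed

section \<open>The two polynomials and their identity\<close>

lemma hstar_eqI:
  fixes P :: "(real ^ 'd) set"
  assumes "ehrhart_series P * (1 - fps_X ^ denominator P) ^ (CARD('d) + 1) = fps_of_poly h"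
  shows "hstar P = h"
  \<comment> \<open>Uniqueness is the injectivity of \<open>fps_of_poly\<close>.\<close>
  unfolding hstar_def using assms by (intro the_equality) (auto simp: fps_of_poly_eq_iff)

lemma hstar_boundary_eqI:
  fixes P :: "(real ^ 'd) set"
  assumes "ehrhart_series (frontier P) * (1 - fps_X ^ denominator P) ^ CARD('d) = fps_of_poly h"
  shows "hstar_boundary P = h"
  unfolding hstar_boundary_def using assms by (intro the_equality) (auto simp: fps_of_poly_eq_iff)

theorem theorem5p2:
  fixes P :: "(real ^ 'd) set" and q :: nat
  assumes "rational_reflexive P"
    and "q = denominator P"
  shows "hstar P = (\<Sum>k<q. monom 1 k) * hstar_boundary P"
proof -
  have rat: "rational_polytope P" using assms(1) by (simp add: rational_reflexive_def)
  then obtain V0 where "finite V0" "P = convex hull V0" by (auto simp: rational_polytope_def)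
  then have P: "convex P" "bounded P"
    by (auto simp: convex_convex_hull intro: compact_imp_bounded finite_imp_compact_convex_hull)
  have "P \<noteq> {}" using assms(1) interior_subset by (auto simp: rational_reflexive_def)
  obtain A where A: "finite A" "A \<subseteq> lattice_points" "P = {x. \<forall>a\<in>A. a \<bullet> x \<le> 1}"
    using assms(1) by (auto simp: rational_reflexive_def)
  have q: "q > 0" "lattice_polytope (dilate q P)" using denominator[OF rat] assms(2) by auto
  then obtain V where V: "finite V" "V \<subseteq> lattice_points" "dilate q P = convex hull V"
    by (auto simp: lattice_polytope_def)
  let ?E = "ehrhart_series P" and ?B = "ehrhart_series (frontier P)"
  let ?Q = "1 - fps_X ^ q :: int fps"
  have B: "?B = (1 - fps_X) * ?E" by (rule ehrhart_series_frontier[OF P(2) A])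
  obtain m p where "?Q ^ m * ?E = fps_of_poly p"
    using ehrhart_series_rational[OF V(1,2) q(1) V(3) P \<open>P \<noteq> {}\<close>] by blast
  \<comment> \<open>The extra factors bring the exponent into the form \<open>d + j\<close> from
    which \<open>fps_pole_order_le_growth\<close> descends to \<open>d\<close>.\<close>
  then have "?Q ^ (CARD('d) + m) * ?B = ?Q ^ CARD('d) * (1 - fps_X) * fps_of_poly p"
    unfolding B by (simp add: power_add ac_simps)
  also have "\<dots> = fps_of_poly ((1 - monom 1 q) ^ CARD('d) * (1 - monom 1 1) * p)"
    by (simp add: fps_of_poly_mult fps_of_poly_power fps_of_poly_diff fps_of_poly_monom)
  finally have "\<exists>p. ?Q ^ (CARD('d) + m) * ?B = fps_of_poly p" by blast
  moreover obtain C where "\<And>n. real_of_int \<bar>?B $ n\<bar> \<le> C * (real n + 1) ^ (CARD('d) - 1)"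
    using ehrhart_series_frontier_growth[OF P(2) A(1,3)] by blast
  ultimately obtain h where h: "?Q ^ CARD('d) * ?B = fps_of_poly h"
    using fps_pole_order_le_growth[OF q(1)] by (metis zero_less_card_finite)
  \<comment> \<open>Multiplying by \<open>1 - fps_X\<close> passes from \<open>P\<close> to its
    boundary, and the extra \<open>?Q\<close> splits as \<open>1 - fps_X\<close> times the geometric
    sum. Cancelling \<open>1 - fps_X\<close> then also shows that the polynomial for
    \<open>P\<close> exists.\<close>
  have "(1 - fps_X) * (?E * ?Q ^ (CARD('d) + 1)) = fps_of_poly h * ?Q"
    unfolding h[symmetric] B by (simp add: ac_simps)
  also have "\<dots> = fps_of_poly h * ((1 - fps_X) * (\<Sum>k<q. fps_X ^ k))"
    by (simp only: one_diff_power_eq)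
  finally have "(1 - fps_X) * (?E * ?Q ^ (CARD('d) + 1)) =
      (1 - fps_X) * fps_of_poly ((\<Sum>k<q. monom 1 k) * h)"
    by (simp only: fps_of_poly_mult fps_of_poly_sum fps_of_poly_monom' ac_simps)
  moreover have "(1 - fps_X :: int fps) \<noteq> 0"
  proof
    assume "(1 - fps_X :: int fps) = 0"
    then have "(1 - fps_X :: int fps) $ 0 = 0" by simp
    then show False by simp
  qed
  ultimately have "?E * ?Q ^ (CARD('d) + 1) = fps_of_poly ((\<Sum>k<q. monom 1 k) * h)"
    by (simp only: mult_cancel_left simp_thms)
  then have "hstar P = (\<Sum>k<q. monom 1 k) * h" using hstar_eqI assms(2) by blast
  moreover have "hstar_boundary P = h"
    by (rule hstar_boundary_eqI) (use h assms(2) in \<open>simp add: mult.commute\<close>)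
  ultimately show ?thesis by simp
qed

end
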